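(* Let $k\geq 3$ be a fixed integer, and let $r_0\in\mathbb{N}$ be such that for all integers $r\geq r_0$ and all integers $\overline{b}$ with $0\leq\overline{b}\leq\binom{r+k-1}{k-1}$, there exist nonnegative integers $a_k,a_{k+1},\dotsc,a_r$ satisfying (i) $\sum_{s=k}^{r}a_s\binom{s}{k}=\overline{b}$, and (ii) $\sum_{s=k}^{r}a_s s\leq r$ (such an $r_0$ exists for every $k\ge 3$). Then for all integers $r\geq r_0$ and all integers $b$ with $\binom{r_0+k-1}{k}\leq b\leq\binom{n}{r}$, where $n=r+k$, an $(n,r,b)$-matrix exists.
   Context: All matrices have entries in $\mathbb{C}$. $\mathbb{N}$ denotes the positive integers. An $(n,r,b)$-matrix is an $r\times n$ matrix with exactly $b$ invertible $r\times r$ submatrices (i.e. exactly $b$ of the $\binom{n}{r}$ choices of $r$ columns give an invertible matrix). *)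

theory Defs
  imports Complex_Main "Jordan_Normal_Form.DL_Submatrix"
begin

text \<open>
  The library function \<open>submatrix A UNIV J\<close> keeps all rows of \<open>A\<close> and the columns with index in
  \<open>J\<close>, in increasing order; columns are numbered \<open>0, \<dots>, n - 1\<close>.
\<close>

definition nrb_matrix :: "nat \<Rightarrow> nat \<Rightarrow> nat \<Rightarrow> complex mat \<Rightarrow> bool" where
  "nrb_matrix n r b A \<longleftrightarrow>
     A \<in> carrier_mat r n \<and>
     card {J. J \<subseteq> {0..<n} \<and> card J = r \<and> invertible_mat (submatrix A UNIV J)} = b"

text \<open>
  Only the values \<open>a s\<close> with \<open>k \<le> s \<le> r\<close> matter. If \<open>r < k\<close> the sums are empty, so that only \<open>0\<close>
  is representable.
\<close>

definition binomial_representable :: "nat \<Rightarrow> nat \<Rightarrow> nat \<Rightarrow> bool" where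
  "binomial_representable k r m \<longleftrightarrow>
     (\<exists>a :: nat \<Rightarrow> nat. (\<Sum>s = k..r. a s * (s choose k)) = m \<and> (\<Sum>s = k..r. a s * s) \<le> r)"

text \<open>
  The rest of this theory shows that for every \<open>k \<ge> 1\<close> all sufficiently large \<open>r\<close> represent every
  \<open>m \<le> (r + k - 1) choose (k - 1)\<close>, by taking the largest possible binomial coefficient greedily.
\<close>

lemma binomial_gap:
  fixes k :: nat
  assumes "k \<ge> 1"
  obtains S where "\<And>r. r \<ge> S \<Longrightarrow> (r + k - 1) choose (k - 1) < (r div 3) choose k"
proof
  fix r :: nat
  assume r: "r \<ge> 3 * (4 ^ k * k ^ k + k + 1)"
  define q where "q = r div 3"
  have q: "q \<ge> 4 ^ k * k ^ k + k + 1"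
    using div_le_mono[OF r, of 3] unfolding q_def by simp
  have rq: "r + k - 1 \<le> 4 * q"
  proof -
    have "r \<le> 3 * q + 2" unfolding q_def by linarith
    thus ?thesis using q by linarith
  qed
  have "k - 1 \<le> r + k - 1" by simp
  from binomial_le_pow[OF this]
  have "(r + k - 1) choose (k - 1) \<le> (4 * q) ^ (k - 1)"
    using rq by (meson le_trans power_mono zero_le)
  hence "((r + k - 1) choose (k - 1)) * k ^ k \<le> (4 ^ (k - 1) * k ^ k) * q ^ (k - 1)"
    by (simp add: power_mult_distrib mult.assoc mult.left_commute)
  also have "\<dots> < q * q ^ (k - 1)"
  proof -
    have "(4::nat) ^ (k - 1) \<le> 4 ^ k" by (rule power_increasing) auto
    hence "4 ^ (k - 1) * k ^ k \<le> 4 ^ k * k ^ k" by simp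
    hence "4 ^ (k - 1) * k ^ k < q" using q by linarith
    moreover have "q > 0" using q by linarith
    ultimately show ?thesis by simp
  qed
  also have "\<dots> = q ^ k" using assms by (cases k) auto
  also have "\<dots> \<le> (q choose k) * k ^ k"
  proof -
    have "k \<le> q" using q by linarith
    from binomial_ge_n_over_k_pow_k[OF this, where 'a = real]
    have "real q ^ k \<le> real (q choose k) * real k ^ k"
      using assms by (simp add: power_divide divide_le_eq)
    hence "real (q ^ k) \<le> real ((q choose k) * k ^ k)" by simp
    thus ?thesis by (simp only: of_nat_le_iff)
  qed
  finally show "(r + k - 1) choose (k - 1) < (r div 3) choose k"
    unfolding q_def by simp
qed

lemma greedy_list:
  fixes k :: nat
  assumes k: "k \<ge> 1"
  obtains D where "\<And>m N. N < m choose k \<Longrightarrow>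
    \<exists>xs. set xs \<subseteq> {k..} \<and> (\<Sum>s\<leftarrow>xs. s choose k) = N \<and> sum_list xs \<le> 2 * m + D"
proof -
  obtain S where S: "\<And>r. r \<ge> S \<Longrightarrow> (r + k - 1) choose (k - 1) < (r div 3) choose k"
    using binomial_gap[OF k] by blast
  have "\<exists>xs. set xs \<subseteq> {k..} \<and> (\<Sum>s\<leftarrow>xs. s choose k) = N \<and>
      sum_list xs \<le> 2 * m + k * (S choose k)" if "N < m choose k" for m N
    using that
  proof (induction m arbitrary: N rule: less_induct)
    case (less m)
    show ?case
    proof (cases "N < S choose k")
      case True
      have "k * N \<le> 2 * m + k * (S choose k)"
        using True by (simp add: trans_le_add2)
      thus ?thesis
        by (intro exI[of _ "replicate N k"]) (auto simp: sum_list_replicate mult.commute)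
    next
      case False
      have SN: "S choose k \<le> N" using False by simp
      have mono: "x choose j \<le> y choose j" if "x \<le> y" for x y j :: nat
        using binomial_right_mono that by blast
      have Sm: "S < m" using SN less.prems mono[of m S k] by linarith
      define s where "s = (GREATEST x. x \<le> m \<and> x choose k \<le> N)"
      have s: "s \<le> m \<and> s choose k \<le> N"
        unfolding s_def by (rule GreatestI_nat[of _ S m]) (use SN Sm in auto)
      have Ss: "S \<le> s"
        unfolding s_def by (rule Greatest_le_nat[of _ S m]) (use SN Sm in auto)
      have sm: "s < m" using s less.prems by (cases "s = m") auto
      have "N < Suc s choose k"
      proof (rule ccontr)
        assume "\<not> N < Suc s choose k"
        hence "Suc s \<le> s"
          unfolding s_def[symmetric] using sm
          by (subst (2) s_def, intro Greatest_le_nat[of _ _ m]) auto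
        thus False by simp
      qed
      hence R: "N - (s choose k) < s choose (k - 1)"
        using s k by (cases k) auto
      also have "\<dots> \<le> (s + k - 1) choose (k - 1)"
        by (rule mono) (use k in auto)
      also have "\<dots> < (s div 3) choose k" using S Ss by blast
      finally have "N - (s choose k) < (s div 3) choose k" .
      moreover have "s div 3 < m" using sm by linarith
      ultimately obtain xs where xs: "set xs \<subseteq> {k..}" "(\<Sum>s\<leftarrow>xs. s choose k) = N - (s choose k)"
        "sum_list xs \<le> 2 * (s div 3) + k * (S choose k)"
        using less.IH by blast
      have "k \<le> s"
      proof (rule ccontr)
        assume "\<not> k \<le> s"
        hence "(s div 3) choose k = 0" by (intro binomial_eq_0) auto
        thus False using S[OF Ss] by linarith
      qed
      moreover have "s + sum_list xs \<le> 2 * m + k * (S choose k)"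
        using xs(3) sm by linarith
      ultimately show ?thesis
        using xs s by (intro exI[of _ "s # xs"]) auto
    qed
  qed
  thus ?thesis using that by blast
qed

lemma binomial_representable_of_list:
  assumes "set xs \<subseteq> {k..}" "(\<Sum>s\<leftarrow>xs. s choose k) = m" "sum_list xs \<le> r"
  shows "binomial_representable k r m"
proof -
  have sub: "set xs \<subseteq> {k..r}"
    using assms(1,3) member_le_sum_list by fastforce
  have "(\<Sum>s\<leftarrow>xs. f s) = (\<Sum>s = k..r. count_list xs s * f s)" for f :: "nat \<Rightarrow> nat"
    by (rule sum_list_map_eq_sum_count2) (use sub in auto)
  from this[of "\<lambda>s. s choose k"] this[of "\<lambda>s. s"] show ?thesis
    unfolding binomial_representable_def using assms
    by (intro exI[of _ "count_list xs"]) auto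
qed

lemma ex_binomial_representable_threshold:
  fixes k :: nat
  assumes k: "k \<ge> 1"
  shows "\<exists>r0 \<ge> 1. \<forall>r \<ge> r0. \<forall>m \<le> (r + k - 1) choose (k - 1). binomial_representable k r m"
proof -
  obtain S where S: "\<And>r. r \<ge> S \<Longrightarrow> (r + k - 1) choose (k - 1) < (r div 3) choose k"
    using binomial_gap[OF k] by blast
  obtain D where D: "\<And>m N. N < m choose k \<Longrightarrow>
    \<exists>xs. set xs \<subseteq> {k..} \<and> (\<Sum>s\<leftarrow>xs. s choose k) = N \<and> sum_list xs \<le> 2 * m + D"
    using greedy_list[OF k] by blast
  have "binomial_representable k r m"
    if r: "r \<ge> S + 3 * D + 1" and m: "m \<le> (r + k - 1) choose (k - 1)" for r m
  proof -
    have "m < (r div 3) choose k" using S[of r] r m by simp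
    from D[OF this] obtain xs where xs: "set xs \<subseteq> {k..}" "(\<Sum>s\<leftarrow>xs. s choose k) = m"
      "sum_list xs \<le> 2 * (r div 3) + D" by blast
    have "2 * (r div 3) + D \<le> r" using r by linarith
    with xs show ?thesis by (intro binomial_representable_of_list) auto
  qed
  thus ?thesis by (intro exI[of _ "S + 3 * D + 1"]) auto
qed

end

theory Submission
  imports Defs "Jordan_Normal_Form.Determinant" "HOL-Library.Function_Algebras"
begin

text \<open>
  The theorem follows by induction on \<open>r\<close>, starting at \<open>r\<^sub>0\<close>. Bordering a matrix by one new row and
  one new column that meet in a \<open>1\<close> and vanish elsewhere keeps the number of invertible maximal
  submatrices, because such a submatrix must use the new column. So if \<open>b\<close> is at most
  \<open>(r + k - 1) choose k\<close>, the largest number attained in the previous step, the induction hypothesis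
  suffices. Otherwise, by Pascal's rule, at most \<open>(r + k - 1) choose (k - 1)\<close> of the \<open>r\<close>-subsets of
  columns have to be singular, and the hypothesis on \<open>r\<^sub>0\<close> writes this number \<open>m\<close> as a sum of binomial
  coefficients \<open>s choose k\<close> with the sum of the numbers \<open>s\<close> at most \<open>r\<close>.

  A matrix with exactly \<open>m\<close> singular submatrices is found on the dual side. If the rows of \<open>A\<close> span
  the space of linear relations among vectors \<open>v\<^sub>0, \<dots>, v\<^sub>n\<^sub>-\<^sub>1\<close> of a \<open>k\<close>-dimensional space, then the
  columns \<open>J\<close> of \<open>A\<close> form a singular matrix iff some nontrivial relation vanishes on \<open>J\<close>, that is, iff
  the \<open>k\<close> vectors outside \<open>J\<close> are dependent (\<open>invertible_submatrix_dual_mat_iff\<close>). So it suffices to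
  find \<open>n\<close> vectors with exactly \<open>m\<close> dependent \<open>k\<close>-subsets. For this, put disjoint groups of \<open>s\<close>
  vectors on generic hyperplanes: a group contributes its \<open>s choose k\<close> subsets of size \<open>k\<close>, and every
  other \<open>k\<close>-subset is independent if the vectors are chosen generically
  (\<open>exists_points_dependent_iff_monochromatic\<close>). The bound \<open>r = n - k\<close> on the total size of the groups
  leaves \<open>k\<close> vectors outside all groups, and these serve as a basis.

  Groups are encoded by a colouring of the indices, an ungrouped vector having a colour of its own;
  the dependent \<open>k\<close>-subsets are then the monochromatic ones.
\<close>

section \<open>Points in prescribed position\<close>

text \<open>
  Induction on the family. Let \<open>x \<in> H\<close> avoid all members but \<open>U\<close>. If \<open>x \<in> U\<close>, pick \<open>y \<in> H\<close> outside \<open>U\<close>.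
  The line through \<open>y\<close> in direction \<open>x\<close> misses \<open>U\<close> and meets every other member in at most one point,
  so over an infinite field it has a point outside all of them.
\<close>

lemma (in vector_space) subspace_not_finite_union:
  assumes inf: "infinite (UNIV :: 'a set)" and "finite F" and H: "subspace H"
    and "\<And>U. U \<in> F \<Longrightarrow> subspace U \<and> \<not> H \<subseteq> U"
  shows "\<exists>x\<in>H. \<forall>U\<in>F. x \<notin> U"
  using assms(2,4)
proof (induction F rule: finite_induct)
  case empty
  show ?case using subspace_0[OF H] by auto
next
  case (insert U F)
  then obtain x where x: "x \<in> H" "\<forall>T\<in>F. x \<notin> T" by auto
  have U: "subspace U" "\<not> H \<subseteq> U" using insert.prems by auto
  show ?case
  proof (cases "x \<in> U")
    case False
    thus ?thesis using x by auto
  next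
    case True
    obtain y where y: "y \<in> H" "y \<notin> U" using U(2) by auto
    have "finite {t. y + t *s x \<in> T}" if T: "T \<in> F" for T
    proof -
      have sT: "subspace T" using insert.prems T by auto
      have "t = t'" if "y + t *s x \<in> T" "y + t' *s x \<in> T" for t t'
      proof (rule ccontr)
        assume "t \<noteq> t'"
        have "(y + t *s x) - (y + t' *s x) \<in> T" by (rule subspace_diff[OF sT that])
        hence "(t - t') *s x \<in> T" by (simp add: scale_left_diff_distrib)
        hence "inverse (t - t') *s ((t - t') *s x) \<in> T" by (rule subspace_scale[OF sT])
        hence "x \<in> T" using \<open>t \<noteq> t'\<close> by simp
        thus False using x T by auto
      qed
      hence "is_singleton {t. y + t *s x \<in> T} \<or> {t. y + t *s x \<in> T} = {}"
        by (metis (mono_tags, lifting) is_singletonI' mem_Collect_eq)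
      thus ?thesis by (auto simp: is_singleton_def)
    qed
    hence "finite (\<Union>T\<in>F. {t. y + t *s x \<in> T})" using insert.hyps by auto
    then obtain t where t: "\<forall>T\<in>F. y + t *s x \<notin> T"
      using ex_new_if_finite[OF inf, of "\<Union>T\<in>F. {t. y + t *s x \<in> T}"] by auto
    have "y + t *s x \<notin> U"
    proof
      assume "y + t *s x \<in> U"
      from subspace_diff[OF U(1) this subspace_scale[OF U(1) True, of t]]
      show False using y by simp
    qed
    moreover have "y + t *s x \<in> H" using H x(1) y(1) by (intro subspace_add subspace_scale)
    ultimately show ?thesis using t by auto
  qed
qed

definition monochromatic :: "('i \<Rightarrow> 'c) \<Rightarrow> 'i set \<Rightarrow> bool" where
  "monochromatic g S \<longleftrightarrow> (\<exists>c. \<forall>i\<in>S. g i = c)"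

text \<open>
  The points are chosen one after the other. While the colour class \<open>G\<close> of the new index has fewer than
  \<open>k - 1\<close> members, the new point may lie anywhere; afterwards it is taken from the hyperplane \<open>H\<close> that
  \<open>G\<close> spans, which makes every \<open>k\<close>-subset of the class dependent. It has to avoid the span of each
  \<open>k - 1\<close> old points that do not all belong to \<open>G\<close>. This is possible by
  \<open>subspace_not_finite_union\<close>: no such span contains \<open>H\<close>, since it would equal \<open>H\<close>, and then a point
  outside \<open>G\<close> together with \<open>k - 1\<close> points of \<open>G\<close> would be dependent without being monochromatic.
  The basis points in front, whose colours are unique, extend any \<open>k - 1\<close> old points to a
  set of size \<open>k\<close> that is not monochromatic, so any \<open>k - 1\<close> old points are independent.
\<close>

lemma (in vector_space) exists_points_dependent_iff_monochromatic:
  fixes e :: "nat \<Rightarrow> 'b" and g :: "nat \<Rightarrow> 'c"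
  assumes inf: "infinite (UNIV :: 'a set)" and k: "k \<ge> 3"
    and e: "inj_on e {..<k}" "independent (e ` {..<k})"
    and "m \<ge> k"
    and "\<And>i j. i < k \<Longrightarrow> j < m \<Longrightarrow> g j = g i \<Longrightarrow> j = i"
  shows "\<exists>v. (\<forall>i<k. v i = e i) \<and> inj_on v {..<m} \<and> v ` {..<m} \<subseteq> span (e ` {..<k}) \<and>
    (\<forall>S\<subseteq>{..<m}. card S = k \<longrightarrow> (dependent (v ` S) \<longleftrightarrow> monochromatic g S))"
  using assms(5,6)
proof (induction m rule: nat_induct_at_least)
  case base
  have "dependent (e ` S) \<longleftrightarrow> monochromatic g S" if S: "S \<subseteq> {..<k}" "card S = k" for S
  proof -
    have "S = {..<k}" using S by (intro card_subset_eq) auto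
    moreover have "\<not> monochromatic g {..<k}"
    proof
      assume "monochromatic g {..<k}"
      hence "g 0 = g 1" using k by (auto simp: monochromatic_def)
      with base[of 1 0] k show False by auto
    qed
    ultimately show ?thesis using e by auto
  qed
  thus ?case using e by (intro exI[of _ e]) (auto intro: span_base)
next
  case (Suc m)
  note sing = Suc.prems
  from Suc.IH sing obtain v where ve: "\<And>i. i < k \<Longrightarrow> v i = e i" and inj: "inj_on v {..<m}"
    and vV: "v ` {..<m} \<subseteq> span (e ` {..<k})"
    and dep: "\<And>S. S \<subseteq> {..<m} \<Longrightarrow> card S = k \<Longrightarrow> dependent (v ` S) \<longleftrightarrow> monochromatic g S"
    by (smt (verit, best) less_SucI)
  have card_v: "card (v ` S) = card S" if "S \<subseteq> {..<m}" for S
    using inj that by (meson card_image inj_on_subset)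
  define G where "G = {i. i < m \<and> g i = g m}"
  have G: "G \<subseteq> {..<m}" "finite G" by (auto simp: G_def)
  have Gk: "i \<notin> G" if "i < k" for i
    using sing[OF that, of m] Suc.hyps that by (auto simp: G_def)
  have indep: "independent (v ` W)" if W: "W \<subseteq> {..<m}" "card W = k - 1" for W
  proof -
    have fW: "finite W" using W finite_subset by blast
    have "\<not> {..<k} \<subseteq> W" using card_mono[OF fW, of "{..<k}"] W k by auto
    then obtain i where i: "i < k" "i \<notin> W" by auto
    have "card W > 0" using W k by simp
    then obtain j where j: "j \<in> W" by (metis card_gt_0_iff ex_in_conv)
    have "\<not> monochromatic g (insert i W)"
    proof
      assume "monochromatic g (insert i W)"
      hence "g j = g i" using j by (auto simp: monochromatic_def)
      thus False using sing[OF i(1), of j] j W i by auto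
    qed
    moreover have "card (insert i W) = k" using W i fW k by simp
    ultimately have "independent (v ` insert i W)"
      using dep[of "insert i W"] W i Suc.hyps by auto
    thus ?thesis by (rule independent_mono) auto
  qed
  define H where "H = (if card G < k - 1 then span (e ` {..<k}) else span (v ` G))"
  have HV: "H \<subseteq> span (e ` {..<k})"
  proof -
    have "v ` G \<subseteq> span (e ` {..<k})" using vV G by blast
    hence "span (v ` G) \<subseteq> span (e ` {..<k})" by (rule span_minimal) (rule subspace_span)
    thus ?thesis by (simp add: H_def)
  qed
  have avoid: "\<not> H \<subseteq> span (v ` W)" if W: "W \<subseteq> {..<m}" "card W = k - 1" "\<not> W \<subseteq> G" for W
  proof
    assume sub: "H \<subseteq> span (v ` W)"
    have fW: "finite W" using W finite_subset by blast
    show False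
    proof (cases "card G < k - 1")
      case True
      hence "e ` {..<k} \<subseteq> span (v ` W)" using sub by (auto simp: H_def intro: span_base)
      from independent_span_bound[OF _ e(2) this] have "card (e ` {..<k}) \<le> card (v ` W)"
        using fW by auto
      thus False using card_image[OF e(1)] card_v[OF W(1)] W(2) k by auto
    next
      case False
      then obtain T where T: "T \<subseteq> G" "card T = k - 1"
        by (meson not_less obtain_subset_with_card_n)
      have Tm: "T \<subseteq> {..<m}" and fT: "finite T" using T G finite_subset by blast+
      obtain w where w: "w \<in> W" "w \<notin> G" using W by auto
      have "v ` T \<subseteq> v ` G" using T by auto
      hence TW: "v ` T \<subseteq> span (v ` W)" using sub False by (auto simp: H_def intro: span_base)
      \<comment> \<open>Both families have \<open>k - 1\<close> members, so the inclusion of spans is an equality.\<close>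
      have "v w \<in> span (v ` T)"
      proof (rule ccontr)
        assume "v w \<notin> span (v ` T)"
        hence "independent (insert (v w) (v ` T))"
          by (rule independent_insertI) (rule indep[OF Tm T(2)])
        moreover have "insert (v w) (v ` T) \<subseteq> span (v ` W)" using TW w by (auto intro: span_base)
        ultimately have "card (insert (v w) (v ` T)) \<le> card (v ` W)"
          using independent_span_bound[of "v ` W"] fW by auto
        moreover have "v w \<notin> v ` T" using \<open>v w \<notin> span (v ` T)\<close> by (auto intro: span_base)
        ultimately show False using card_v[OF W(1)] card_v[OF Tm] W(2) T(2) fT by simp
      qed
      have wT: "w \<notin> T" using w T by auto
      have "v w \<notin> v ` T" using inj wT w W Tm by (auto dest: inj_onD)
      hence "dependent (v ` insert w T)"
        using \<open>v w \<in> span (v ` T)\<close> independent_insert[of "v w" "v ` T"] by auto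
      moreover have "card (insert w T) = k" using wT fT T k by simp
      ultimately have mono: "monochromatic g (insert w T)"
        using dep[of "insert w T"] Tm w W by auto
      have "card T > 0" using T k by simp
      then obtain j where "j \<in> T" by (metis card_gt_0_iff ex_in_conv)
      hence "g w = g m" using mono T by (auto simp: monochromatic_def G_def)
      thus False using w W by (auto simp: G_def)
    qed
  qed
  let ?\<W> = "{W. W \<subseteq> {..<m} \<and> card W = k - 1 \<and> \<not> W \<subseteq> G}"
  have "\<exists>x\<in>H. \<forall>U\<in>(\<lambda>W. span (v ` W)) ` ?\<W>. x \<notin> U"
  proof (rule subspace_not_finite_union[OF inf])
    have "finite ?\<W>" by (rule finite_subset[of _ "Pow {..<m}"]) auto
    thus "finite ((\<lambda>W. span (v ` W)) ` ?\<W>)" by (rule finite_imageI)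
    show "subspace H" by (simp add: H_def)
  qed (use avoid in auto)
  then obtain x where x: "x \<in> H"
    and xW: "\<And>W. W \<subseteq> {..<m} \<Longrightarrow> card W = k - 1 \<Longrightarrow> \<not> W \<subseteq> G \<Longrightarrow> x \<notin> span (v ` W)"
    by auto
  \<comment> \<open>Since \<open>k - 1 \<ge> 2\<close>, every old index \<open>i\<close> lies together with \<open>0\<close> in one of the sets whose spans
    are avoided; this is what makes the new point differ from all old ones.\<close>
  have new: "x \<notin> v ` {..<m}"
  proof
    assume "x \<in> v ` {..<m}"
    then obtain i where i: "i < m" "x = v i" by auto
    have "card {0, i} \<le> 2" by (simp add: card_insert_if)
    hence "card {0, i} \<le> k - 1" using k by linarith
    moreover have "k - 1 \<le> card {..<m}" "{0, i} \<subseteq> {..<m}" using i k Suc.hyps by auto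
    ultimately obtain W where W: "{0, i} \<subseteq> W" "W \<subseteq> {..<m}" "card W = k - 1"
      using exists_subset_between[of "{0, i}" "k - 1" "{..<m}"] by blast
    have "\<not> W \<subseteq> G" using Gk[of 0] k W by auto
    with xW[OF W(2,3)] i W show False by (auto intro: span_base)
  qed
  define v' where "v' = v(m := x)"
  have v'_old: "v' ` S = v ` S" if "S \<subseteq> {..<m}" for S using that by (auto simp: v'_def)
  have "inj_on v' {..<Suc m}"
    using inj new by (auto simp: v'_def inj_on_def lessThan_Suc)
  moreover have "v' ` {..<Suc m} \<subseteq> span (e ` {..<k})"
    using vV x HV by (auto simp: v'_def lessThan_Suc)
  moreover have "\<forall>i<k. v' i = e i" using ve Suc.hyps by (auto simp: v'_def)
  moreover have "dependent (v' ` S) \<longleftrightarrow> monochromatic g S"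
    if S: "S \<subseteq> {..<Suc m}" "card S = k" for S
  proof (cases "m \<in> S")
    case False
    hence "S \<subseteq> {..<m}" using S by (auto simp: lessThan_Suc)
    thus ?thesis using dep v'_old S by auto
  next
    case True
    define W where "W = S - {m}"
    have W: "W \<subseteq> {..<m}" "card W = k - 1" "S = insert m W"
      using S True by (auto simp: W_def lessThan_Suc)
    have fW: "finite W" using W finite_subset by blast
    have "v' ` S = insert x (v ` W)" using v'_old[OF W(1)] W(3) by (auto simp: v'_def)
    moreover have "x \<notin> v ` W" using new W by auto
    ultimately have "dependent (v' ` S) \<longleftrightarrow> x \<in> span (v ` W)"
      using indep[OF W(1,2)] independent_insert[of x "v ` W"] by auto
    also have "\<dots> \<longleftrightarrow> W \<subseteq> G"
    proof
      assume "x \<in> span (v ` W)"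
      thus "W \<subseteq> G" using xW W by blast
    next
      assume WG: "W \<subseteq> G"
      have "card W \<le> card G" using WG G by (intro card_mono)
      hence "x \<in> span (v ` G)" using x W(2) by (auto simp: H_def)
      moreover have "v i \<in> span (v ` W)" if i: "i \<in> G" for i
      proof (cases "i \<in> W")
        case True
        thus ?thesis by (auto intro: span_base)
      next
        case False
        have "card (insert i W) = k" using False fW W(2) k by simp
        moreover have "monochromatic g (insert i W)"
          using i WG by (auto simp: monochromatic_def G_def)
        ultimately have "dependent (v ` insert i W)" using dep[of "insert i W"] i W G by auto
        thus ?thesis using indep[OF W(1,2)] by (metis image_insert independent_insertI)
      qed
      ultimately show "x \<in> span (v ` W)"
        using span_minimal[of "v ` G" "span (v ` W)"] by auto
    qed
    also have "\<dots> \<longleftrightarrow> monochromatic g S"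
      using W by (auto simp: monochromatic_def G_def)
    finally show ?thesis .
  qed
  ultimately show ?case by (intro exI[of _ v'] conjI allI impI) simp_all
qed

section \<open>Counting monochromatic sets\<close>

text \<open>
  Start with \<open>p\<close> indices of different colours and append one block of a new colour for every entry of the
  list. Colouring each block by its first index makes the colour new, because \<open>g i \<le> i\<close> holds so far.
\<close>

lemma exists_colouring_of_list:
  fixes p k :: nat
  assumes k: "k \<ge> 2"
  shows "\<exists>g. (\<forall>i<p. g i = i) \<and> (\<forall>i\<ge>p. p \<le> g i) \<and> (\<forall>i. g i \<le> i) \<and>
    card {S. S \<subseteq> {..<p + sum_list xs} \<and> card S = k \<and> monochromatic g S} = (\<Sum>s\<leftarrow>xs. s choose k)"
proof (induction xs)
  case Nil
  have "{S. S \<subseteq> {..<p} \<and> card S = k \<and> monochromatic (\<lambda>i. i) S} = {}"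
  proof -
    have "card S \<le> 1" if mono: "monochromatic (\<lambda>i. i) S" for S :: "nat set"
    proof -
      obtain c where "\<forall>i\<in>S. i = c" using mono by (auto simp: monochromatic_def)
      hence "S \<subseteq> {c}" by blast
      from card_mono[OF _ this] show ?thesis by simp
    qed
    thus ?thesis using k by fastforce
  qed
  thus ?case by (intro exI[of _ "\<lambda>i. i"]) simp
next
  case (Cons x xs)
  then obtain g where g: "\<And>i. i < p \<Longrightarrow> g i = i" "\<And>i. i \<ge> p \<Longrightarrow> p \<le> g i" "\<And>i. g i \<le> i"
    and card: "card {S. S \<subseteq> {..<p + sum_list xs} \<and> card S = k \<and> monochromatic g S} = (\<Sum>s\<leftarrow>xs. s choose k)"
    by auto
  define N where "N = p + sum_list xs"
  define h where "h i = (if i < N then g i else N)" for i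
  let ?A = "{S. S \<subseteq> {..<N} \<and> card S = k \<and> monochromatic g S}"
  let ?B = "{S. S \<subseteq> {N..<N + x} \<and> card S = k}"
  have "{S. S \<subseteq> {..<N + x} \<and> card S = k \<and> monochromatic h S} = ?A \<union> ?B"
  proof (intro equalityI subsetI)
    fix S assume "S \<in> {S. S \<subseteq> {..<N + x} \<and> card S = k \<and> monochromatic h S}"
    hence S: "S \<subseteq> {..<N + x}" "card S = k" "monochromatic h S" by auto
    then obtain c where c: "\<And>i. i \<in> S \<Longrightarrow> h i = c" by (auto simp: monochromatic_def)
    \<comment> \<open>The old colours are below \<open>N\<close>, so a monochromatic set lies within the old indices or the new
      block.\<close>
    have lt: "h i < N \<longleftrightarrow> i < N" for i using g(3)[of i] by (auto simp: h_def)
    show "S \<in> ?A \<union> ?B"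
    proof (cases "c < N")
      case True
      hence "S \<subseteq> {..<N}" using lt c by blast
      moreover have "monochromatic g S" using c calculation
        by (auto simp: monochromatic_def h_def subset_iff intro!: exI[of _ c])
      ultimately show ?thesis using S by auto
    next
      case False
      have "i \<in> {N..<N + x}" if "i \<in> S" for i
        using lt[of i] c[OF that] S(1) that False by auto
      thus ?thesis using S by blast
    qed
  next
    fix S assume "S \<in> ?A \<union> ?B"
    thus "S \<in> {S. S \<subseteq> {..<N + x} \<and> card S = k \<and> monochromatic h S}"
    proof
      assume "S \<in> ?A"
      thus ?thesis by (force simp: monochromatic_def h_def subset_iff)
    next
      assume "S \<in> ?B"
      thus ?thesis by (force simp: monochromatic_def h_def subset_iff)
    qed
  qed
  moreover have "card (?A \<union> ?B) = card ?A + card ?B"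
  proof (rule card_Un_disjoint)
    show "finite ?A" by (rule finite_subset[of _ "Pow {..<N}"]) auto
    show "finite ?B" by (rule finite_subset[of _ "Pow {N..<N + x}"]) auto
    show "?A \<inter> ?B = {}"
    proof (rule equals0I)
      fix S assume S: "S \<in> ?A \<inter> ?B"
      hence "S \<subseteq> {..<N} \<inter> {N..<N + x}" by blast
      also have "\<dots> = {}" by auto
      finally have "S = {}" by simp
      thus False using S k by simp
    qed
  qed
  moreover have "card ?B = x choose k" by (simp add: n_subsets)
  ultimately have "card {S. S \<subseteq> {..<p + sum_list (x # xs)} \<and> card S = k \<and> monochromatic h S}
      = (\<Sum>s\<leftarrow>x # xs. s choose k)"
    using card by (simp add: N_def add_ac)
  moreover have "\<forall>i<p. h i = i" using g by (simp add: h_def N_def)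
  moreover have "\<forall>i\<ge>p. p \<le> h i" using g by (simp add: h_def N_def)
  moreover have "\<forall>i. h i \<le> i" using g by (simp add: h_def)
  ultimately show ?case by blast
qed

lemma exists_colouring:
  fixes k r m :: nat
  assumes k: "k \<ge> 2" and "binomial_representable k r m"
  obtains g :: "nat \<Rightarrow> nat" where
    "\<And>i j. i < k \<Longrightarrow> g j = g i \<Longrightarrow> j = i"
    "card {S. S \<subseteq> {..<r + k} \<and> card S = k \<and> monochromatic g S} = m"
proof -
  obtain a where a: "(\<Sum>s = k..r. a s * (s choose k)) = m" "(\<Sum>s = k..r. a s * s) \<le> r"
    using assms(2) by (auto simp: binomial_representable_def)
  define xs where "xs = concat (map (\<lambda>s. replicate (a s) s) [k..<Suc r])"
  have xs: "(\<Sum>s\<leftarrow>xs. f s) = (\<Sum>s = k..r. a s * f s)" for f :: "nat \<Rightarrow> nat"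
  proof -
    have "(\<Sum>s\<leftarrow>concat (map (\<lambda>s. replicate (a s) s) ys). f s) = (\<Sum>s\<leftarrow>ys. a s * f s)" for ys
      by (induction ys) (auto simp: sum_list_replicate)
    thus ?thesis
      by (simp add: xs_def interv_sum_list_conv_sum_set_nat atLeastLessThanSuc_atLeastAtMost del: upt_Suc)
  qed
  have size: "sum_list xs \<le> r" using xs[of "\<lambda>s. s"] a by simp
  define p where "p = r + k - sum_list xs"
  have p: "p + sum_list xs = r + k" "k \<le> p" using size by (auto simp: p_def)
  obtain g where g: "\<And>i. i < p \<Longrightarrow> g i = i" "\<And>i. i \<ge> p \<Longrightarrow> p \<le> g i"
    "card {S. S \<subseteq> {..<r + k} \<and> card S = k \<and> monochromatic g S} = (\<Sum>s\<leftarrow>xs. s choose k)"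
    using exists_colouring_of_list[OF k, of p xs] p by auto
  show ?thesis
  proof (rule that)
    show "card {S. S \<subseteq> {..<r + k} \<and> card S = k \<and> monochromatic g S} = m" using g xs a by simp
    show "j = i" if "i < k" "g j = g i" for i j
      using that g(1)[of i] g(1)[of j] g(2)[of j] p(2) by (cases "j < p") auto
  qed
qed

section \<open>Maximal minors and duality\<close>

lemma invertible_mat_iff_det:
  fixes A :: "'a :: field mat"
  assumes A: "A \<in> carrier_mat n n"
  shows "invertible_mat A \<longleftrightarrow> det A \<noteq> 0"
proof
  assume "invertible_mat A"
  then obtain B where B: "A * B = 1\<^sub>m n" "B * A = 1\<^sub>m (dim_row B)"
    using A by (auto simp: invertible_mat_def inverts_mat_def)
  have "dim_col B = n" using arg_cong[OF B(1), of dim_col] by simp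
  moreover have "dim_row B = n" using arg_cong[OF B(2), of dim_col] A by simp
  ultimately have "B \<in> carrier_mat n n" by auto
  from det_mult[OF A this] B show "det A \<noteq> 0" by auto
next
  assume "det A \<noteq> 0"
  from det_non_zero_imp_unit[OF A this, of "()"] obtain B
    where "B \<in> carrier_mat n n" "B * A = 1\<^sub>m n" "A * B = 1\<^sub>m n"
    by (auto simp: Units_def ring_mat_simps)
  thus "invertible_mat A" using A by (auto simp: invertible_mat_def inverts_mat_def)
qed

text \<open>
  Invertibility as the absence of a nontrivial relation between the rows: unlike the determinant, this
  form does not depend on the order in which \<open>submatrix\<close> lists the columns.
\<close>

lemma invertible_submatrix_iff:
  fixes A :: "'a :: field mat"
  assumes A: "A \<in> carrier_mat r n" and J: "J \<subseteq> {0..<n}" "card J = r"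
  shows "invertible_mat (submatrix A UNIV J) \<longleftrightarrow>
    (\<forall>y. (\<forall>j\<in>J. (\<Sum>i<r. y i * A $$ (i, j)) = 0) \<longrightarrow> (\<forall>i<r. y i = 0))"
proof -
  define M where "M = submatrix A UNIV J"
  have Jn: "{j. j < n \<and> j \<in> J} = J" using J by auto
  have M: "M \<in> carrier_mat r r"
    using A J(2) by (intro carrier_matI) (simp_all add: M_def dim_submatrix Jn)
  have Mij: "M $$ (i, j) = A $$ (i, pick J j)" if "i < r" "j < r" for i j
  proof -
    have "i < card {i. i < dim_row A \<and> i \<in> (UNIV :: nat set)}"
      "j < card {j. j < dim_col A \<and> j \<in> J}"
      using that A J(2) by (simp_all add: Jn)
    from submatrix_index[OF this] show ?thesis by (simp add: M_def pick_UNIV)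
  qed
  have pick: "pick J ` {..<r} = J"
  proof (rule card_subset_eq)
    show "finite J" using J finite_subset by blast
    show sub: "pick J ` {..<r} \<subseteq> J" using J by (auto intro: pick_in_set_le)
    have "inj_on (pick J) {..<r}"
      by (rule strict_mono_on_imp_inj_on) (use J in \<open>auto simp: strict_mono_on_def intro: pick_mono_le\<close>)
    thus "card (pick J ` {..<r}) = card J" using J by (simp add: card_image)
  qed
  have "(M\<^sup>T *\<^sub>v v = 0\<^sub>v r) \<longleftrightarrow> (\<forall>j\<in>J. (\<Sum>i<r. v $ i * A $$ (i, j)) = 0)"
    if v: "v \<in> carrier_vec r" for v
  proof -
    have "(M\<^sup>T *\<^sub>v v) $ j = (\<Sum>i<r. v $ i * A $$ (i, pick J j))" if "j < r" for j
      using that v M Mij by (auto simp: scalar_prod_def lessThan_atLeast0 mult.commute intro!: sum.cong)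
    hence "(M\<^sup>T *\<^sub>v v = 0\<^sub>v r) \<longleftrightarrow> (\<forall>j<r. (\<Sum>i<r. v $ i * A $$ (i, pick J j)) = 0)"
      using M by (auto simp: vec_eq_iff)
    thus ?thesis by (subst pick[symmetric]) auto
  qed
  hence det: "det M = 0 \<longleftrightarrow> (\<exists>v \<in> carrier_vec r. v \<noteq> 0\<^sub>v r \<and>
      (\<forall>j\<in>J. (\<Sum>i<r. v $ i * A $$ (i, j)) = 0))"
    using det_0_iff_vec_prod_zero[of "M\<^sup>T" r] det_transpose[OF M] M by auto
  also have "\<dots> \<longleftrightarrow> (\<exists>y. (\<exists>i<r. y i \<noteq> 0) \<and> (\<forall>j\<in>J. (\<Sum>i<r. y i * A $$ (i, j)) = 0))"
  proof
    assume "\<exists>v \<in> carrier_vec r. v \<noteq> 0\<^sub>v r \<and> (\<forall>j\<in>J. (\<Sum>i<r. v $ i * A $$ (i, j)) = 0)"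
    then obtain v where "v \<in> carrier_vec r" "v \<noteq> 0\<^sub>v r"
      "\<forall>j\<in>J. (\<Sum>i<r. v $ i * A $$ (i, j)) = 0" by auto
    thus "\<exists>y. (\<exists>i<r. y i \<noteq> 0) \<and> (\<forall>j\<in>J. (\<Sum>i<r. y i * A $$ (i, j)) = 0)"
      by (intro exI[of _ "\<lambda>i. v $ i"]) (auto simp: vec_eq_iff)
  next
    assume "\<exists>y. (\<exists>i<r. y i \<noteq> 0) \<and> (\<forall>j\<in>J. (\<Sum>i<r. y i * A $$ (i, j)) = 0)"
    then obtain y where "\<exists>i<r. y i \<noteq> 0" "\<forall>j\<in>J. (\<Sum>i<r. y i * A $$ (i, j)) = 0" by auto
    thus "\<exists>v \<in> carrier_vec r. v \<noteq> 0\<^sub>v r \<and> (\<forall>j\<in>J. (\<Sum>i<r. v $ i * A $$ (i, j)) = 0)"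
      by (intro bexI[of _ "vec r y"]) (auto simp: vec_eq_iff)
  qed
  finally show ?thesis using invertible_mat_iff_det[OF M] by (auto simp: M_def)
qed

text \<open>
  Since \<open>k\<close> is a variable, the \<open>k\<close>-dimensional space is realised inside the space of all sequences, as
  those vanishing from index \<open>k\<close> on.
\<close>

interpretation fun_vs: Vector_Spaces.vector_space "\<lambda>(c :: 'a :: field) (f :: nat \<Rightarrow> 'a) x. c * f x"
  by unfold_locales (auto simp: fun_eq_iff algebra_simps)

lemma sum_fun_apply: "(\<Sum>i\<in>S. f i) x = (\<Sum>i\<in>S. f i x)"
  for f :: "'i \<Rightarrow> 'x \<Rightarrow> 'a :: comm_monoid_add"
  by (induction S rule: infinite_finite_induct) auto

lemma fun_dependent_image_iff:
  fixes v :: "'i \<Rightarrow> nat \<Rightarrow> 'a :: field"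
  assumes "finite K" "inj_on v K"
  shows "fun_vs.dependent (v ` K) \<longleftrightarrow>
    (\<exists>u. (\<exists>c\<in>K. u c \<noteq> 0) \<and> (\<forall>x. (\<Sum>c\<in>K. u c * v c x) = 0))"
proof -
  have "fun_vs.dependent (v ` K) \<longleftrightarrow>
    (\<exists>u. (\<exists>c\<in>K. u (v c) \<noteq> 0) \<and> (\<forall>x. (\<Sum>c\<in>K. u (v c) * v c x) = 0))"
    using assms by (simp add: fun_vs.dependent_finite sum.reindex fun_eq_iff sum_fun_apply)
  also have "\<dots> \<longleftrightarrow> (\<exists>u. (\<exists>c\<in>K. u c \<noteq> 0) \<and> (\<forall>x. (\<Sum>c\<in>K. u c * v c x) = 0))"
  proof
    assume "\<exists>u. (\<exists>c\<in>K. u c \<noteq> 0) \<and> (\<forall>x. (\<Sum>c\<in>K. u c * v c x) = 0)"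
    then obtain u where u: "\<exists>c\<in>K. u c \<noteq> 0" "\<forall>x. (\<Sum>c\<in>K. u c * v c x) = 0" by auto
    thus "\<exists>u. (\<exists>c\<in>K. u (v c) \<noteq> 0) \<and> (\<forall>x. (\<Sum>c\<in>K. u (v c) * v c x) = 0)"
      using assms(2) by (intro exI[of _ "\<lambda>f. u (the_inv_into K v f)"]) (auto simp: the_inv_into_f_f)
  qed auto
  finally show ?thesis .
qed

text \<open>
  If the vectors \<open>v 0, \<dots>, v (k - 1)\<close> are the unit vectors, the linear relations among
  \<open>v 0, \<dots>, v (r + k - 1)\<close> are spanned by those that express \<open>v (k + i)\<close> in this basis. They are the rows
  of the following matrix \<open>[-N\<^sup>T | I]\<close>, where \<open>N\<close> has the columns \<open>v k, \<dots>, v (r + k - 1)\<close>.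
\<close>

definition dual_mat :: "nat \<Rightarrow> nat \<Rightarrow> (nat \<Rightarrow> nat \<Rightarrow> 'a :: field) \<Rightarrow> 'a mat" where
  "dual_mat r k v = mat r (r + k) (\<lambda>(i, c). if c < k then - v (k + i) c else if c = k + i then 1 else 0)"

text \<open>
  A combination \<open>y\<close> of the rows of \<open>dual_mat r k v\<close> is the linear relation with coefficients \<open>y i\<close> at
  \<open>k + i\<close>, and every relation arises in this way. If it vanishes on \<open>J\<close>, it is a relation among the
  vectors outside \<open>J\<close>.
\<close>

lemma invertible_submatrix_dual_mat_iff:
  fixes v :: "nat \<Rightarrow> nat \<Rightarrow> 'a :: field"
  assumes inj: "inj_on v {..<r + k}"
    and unit: "\<And>i x. i < k \<Longrightarrow> v i x = (if x = i then 1 else 0)"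
    and supp: "\<And>i x. i < r + k \<Longrightarrow> k \<le> x \<Longrightarrow> v i x = 0"
    and J: "J \<subseteq> {0..<r + k}" "card J = r"
  shows "invertible_mat (submatrix (dual_mat r k v) UNIV J) \<longleftrightarrow>
    fun_vs.independent (v ` ({..<r + k} - J))"
proof -
  define K where "K = {..<r + k} - J"
  have K: "finite K" "K \<subseteq> {..<r + k}" by (auto simp: K_def)
  have A: "dual_mat r k v \<in> carrier_mat r (r + k)" by (simp add: dual_mat_def)
  have split: "(\<Sum>c<r + k. f c) = (\<Sum>c<k. f c) + (\<Sum>i<r. f (k + i))" for f :: "nat \<Rightarrow> 'a"
    by (induction r) (auto simp: add_ac)
  have col_lo: "(\<Sum>i<r. y i * dual_mat r k v $$ (i, c)) = - (\<Sum>i<r. y i * v (k + i) c)"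
    if "c < k" for y c
    using that by (simp add: dual_mat_def sum_negf)
  have col_hi: "(\<Sum>i<r. y i * dual_mat r k v $$ (i, k + j)) = y j" if "j < r" for y j
  proof -
    have "(\<Sum>i<r. y i * dual_mat r k v $$ (i, k + j)) = (\<Sum>i<r. if i = j then y i else 0)"
      using that by (intro sum.cong) (auto simp: dual_mat_def)
    thus ?thesis using that by simp
  qed
  have relation: "(\<Sum>c<r + k. u c * v c x) =
      (if x < k then u x + (\<Sum>i<r. u (k + i) * v (k + i) x) else 0)" for u x
  proof -
    have "(\<Sum>c<k. u c * v c x) = (\<Sum>c<k. if c = x then u c else 0)"
      using unit by (intro sum.cong) auto
    thus ?thesis using supp by (auto simp: split not_less)
  qed
  have "(\<exists>y. (\<exists>i<r. y i \<noteq> 0) \<and> (\<forall>j\<in>J. (\<Sum>i<r. y i * dual_mat r k v $$ (i, j)) = 0)) \<longleftrightarrow>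
    (\<exists>u. (\<exists>c\<in>K. u c \<noteq> 0) \<and> (\<forall>x. (\<Sum>c\<in>K. u c * v c x) = 0))" (is "?L \<longleftrightarrow> ?R")
  proof
    assume ?L
    then obtain y i where y: "\<forall>j\<in>J. (\<Sum>i<r. y i * dual_mat r k v $$ (i, j)) = 0"
      and i: "i < r" "y i \<noteq> 0" by blast
    define u where "u c = (\<Sum>i<r. y i * dual_mat r k v $$ (i, c))" for c
    have "(\<Sum>c\<in>K. u c * v c x) = (\<Sum>c<r + k. u c * v c x)" for x
      using y by (intro sum.mono_neutral_left) (auto simp: K_def u_def)
    moreover have "(\<Sum>c<r + k. u c * v c x) = 0" for x
      by (simp add: relation) (simp add: u_def col_lo col_hi)
    moreover have "u (k + i) \<noteq> 0" using i by (simp add: u_def col_hi)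
    moreover from this have "k + i \<in> K" using i y by (auto simp: K_def u_def)
    ultimately show ?R by (intro exI[of _ u]) auto
  next
    assume ?R
    then obtain u where u: "\<exists>c\<in>K. u c \<noteq> 0" "\<And>x. (\<Sum>c\<in>K. u c * v c x) = 0" by auto
    define w where "w c = (if c \<in> K then u c else 0)" for c
    have "(\<Sum>c<r + k. w c * v c x) = (\<Sum>c\<in>K. u c * v c x)" for x
      using K by (intro sum.mono_neutral_cong_right) (auto simp: w_def)
    hence w: "w x = - (\<Sum>i<r. w (k + i) * v (k + i) x)" if "x < k" for x
      using relation[of w x] u(2)[of x] that by (simp add: eq_neg_iff_add_eq_0)
    have col: "(\<Sum>i<r. w (k + i) * dual_mat r k v $$ (i, c)) = w c" if c: "c < r + k" for c
    proof (cases "c < k")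
      case True
      thus ?thesis by (simp add: col_lo w)
    next
      case False
      then obtain j where "c = k + j" by (metis le_Suc_ex not_less)
      thus ?thesis using c col_hi[of j "\<lambda>i. w (k + i)"] by simp
    qed
    have "(\<Sum>i<r. w (k + i) * dual_mat r k v $$ (i, j)) = 0" if "j \<in> J" for j
      using col[of j] that J by (auto simp: w_def K_def)
    moreover have "\<exists>i<r. w (k + i) \<noteq> 0"
    proof (rule ccontr)
      assume "\<not> (\<exists>i<r. w (k + i) \<noteq> 0)"
      hence "w c = 0" if "c < r + k" for c using col[OF that] by simp
      moreover obtain c where "c \<in> K" "u c \<noteq> 0" using u(1) by blast
      ultimately show False using K(2) by (metis lessThan_iff subsetD w_def)
    qed
    ultimately show ?L by (intro exI[of _ "\<lambda>i. w (k + i)"]) auto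
  qed
  moreover have "inj_on v K" using inj K(2) by (rule inj_on_subset)
  ultimately show ?thesis
    using fun_dependent_image_iff[OF K(1), of v] invertible_submatrix_iff[OF A J]
    unfolding K_def by blast
qed

section \<open>Existence of the matrices\<close>

lemma exists_nrb_matrix_of_representable:
  assumes k: "k \<ge> 3" and rep: "binomial_representable k r m"
  shows "\<exists>A. nrb_matrix (r + k) r (((r + k) choose k) - m) A"
proof -
  define n where "n = r + k"
  obtain g :: "nat \<Rightarrow> nat" where g: "\<And>i j. i < k \<Longrightarrow> g j = g i \<Longrightarrow> j = i"
    and m: "card {S. S \<subseteq> {..<n} \<and> card S = k \<and> monochromatic g S} = m"
    using exists_colouring[of k r m] k rep unfolding n_def by auto
  define e :: "nat \<Rightarrow> nat \<Rightarrow> complex" where "e i x = (if x = i then 1 else 0)" for i x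
  have inj_e: "inj_on e {..<k}"
    by (rule inj_onI) (metis e_def zero_neq_one)
  have indep_e: "fun_vs.independent (e ` {..<k})"
  proof -
    have "(\<Sum>c<k. u c * e c x) = u x" if "x < k" for u x
    proof -
      have "(\<Sum>c<k. u c * e c x) = (\<Sum>c<k. if c = x then u c else 0)"
        by (intro sum.cong) (auto simp: e_def)
      thus ?thesis using that by simp
    qed
    thus ?thesis using fun_dependent_image_iff[OF _ inj_e] by (metis finite_lessThan lessThan_iff)
  qed
  have "k \<le> n" by (simp add: n_def)
  from fun_vs.exists_points_dependent_iff_monochromatic
      [OF infinite_UNIV_char_0 k inj_e indep_e this, of g] g
  obtain v where v: "\<And>i. i < k \<Longrightarrow> v i = e i" "inj_on v {..<n}"
    "v ` {..<n} \<subseteq> fun_vs.span (e ` {..<k})"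
    and dep: "\<And>S. S \<subseteq> {..<n} \<Longrightarrow> card S = k \<Longrightarrow> fun_vs.dependent (v ` S) \<longleftrightarrow> monochromatic g S"
    by (metis (no_types, lifting))
  have "fun_vs.span (e ` {..<k}) \<subseteq> {f. \<forall>x\<ge>k. f x = 0}"
    by (rule fun_vs.span_minimal) (auto simp: e_def fun_vs.subspace_def)
  hence supp: "v i x = 0" if "i < n" "k \<le> x" for i x using v(3) that by blast
  have inv: "invertible_mat (submatrix (dual_mat r k v) UNIV J) \<longleftrightarrow> \<not> monochromatic g ({..<n} - J)"
    if J: "J \<subseteq> {0..<n}" "card J = r" for J
  proof -
    have "card ({..<n} - J) = k"
      using J finite_subset[OF J(1)] by (simp add: card_Diff_subset n_def lessThan_atLeast0)
    hence "fun_vs.dependent (v ` ({..<n} - J)) \<longleftrightarrow> monochromatic g ({..<n} - J)"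
      by (intro dep) auto
    moreover have "invertible_mat (submatrix (dual_mat r k v) UNIV J) \<longleftrightarrow>
        fun_vs.independent (v ` ({..<n} - J))"
      unfolding n_def
    proof (rule invertible_submatrix_dual_mat_iff)
      show "v i x = (if x = i then 1 else 0)" if "i < k" for i x
        using v(1)[OF that] by (simp add: e_def)
    qed (use v(2) supp J in \<open>auto simp: n_def\<close>)
    ultimately show ?thesis by simp
  qed
  have "card {J. J \<subseteq> {0..<n} \<and> card J = r \<and> invertible_mat (submatrix (dual_mat r k v) UNIV J)}
      = card {S. S \<subseteq> {..<n} \<and> card S = k \<and> \<not> monochromatic g S}"
  proof (rule bij_betw_same_card[of "\<lambda>J. {..<n} - J"], rule bij_betw_byWitness[where f' = "\<lambda>J. {..<n} - J"])
    have card: "card ({..<n} - S) = n - card S" if "S \<subseteq> {..<n}" for S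
      using that finite_subset[OF that] by (simp add: card_Diff_subset)
    show "(\<lambda>J. {..<n} - J) ` {J. J \<subseteq> {0..<n} \<and> card J = r \<and>
        invertible_mat (submatrix (dual_mat r k v) UNIV J)}
      \<subseteq> {S. S \<subseteq> {..<n} \<and> card S = k \<and> \<not> monochromatic g S}"
      using inv card by (auto simp: n_def lessThan_atLeast0)
    have "invertible_mat (submatrix (dual_mat r k v) UNIV ({..<n} - S))"
      if S: "S \<subseteq> {..<n}" "card S = k" "\<not> monochromatic g S" for S
    proof -
      have "{..<n} - ({..<n} - S) = S" using S by auto
      thus ?thesis using S inv[of "{..<n} - S"] card[OF S(1)]
        by (simp add: n_def lessThan_atLeast0)
    qed
    thus "(\<lambda>J. {..<n} - J) ` {S. S \<subseteq> {..<n} \<and> card S = k \<and> \<not> monochromatic g S}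
      \<subseteq> {J. J \<subseteq> {0..<n} \<and> card J = r \<and> invertible_mat (submatrix (dual_mat r k v) UNIV J)}"
      using card by (auto simp: n_def)
  qed auto
  also have "\<dots> = card ({S. S \<subseteq> {..<n} \<and> card S = k} -
      {S. S \<subseteq> {..<n} \<and> card S = k \<and> monochromatic g S})"
    by (rule arg_cong[of _ _ card]) auto
  also have "\<dots> = (n choose k) - m"
  proof (subst card_Diff_subset)
    show "finite {S. S \<subseteq> {..<n} \<and> card S = k \<and> monochromatic g S}"
      by (rule finite_subset[of _ "Pow {..<n}"]) auto
    show "card {S. S \<subseteq> {..<n} \<and> card S = k} - card {S. S \<subseteq> {..<n} \<and> card S = k \<and> monochromatic g S}
        = (n choose k) - m"
      using n_subsets[of "{..<n}" k] m by simp
  qed auto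
  finally have "nrb_matrix n r ((n choose k) - m) (dual_mat r k v)"
    by (simp add: nrb_matrix_def n_def dual_mat_def)
  thus ?thesis unfolding n_def by blast
qed

text \<open>
  The border is a unit row and a unit column that meet in the corner. Columns avoiding the new one have
  a zero in the last row, hence are singular; with the new one, the block structure reduces to \<open>A\<close>.
\<close>

lemma exists_nrb_matrix_Suc:
  assumes A: "nrb_matrix n r b A"
  shows "\<exists>B. nrb_matrix (Suc n) (Suc r) b B"
proof -
  define B where "B = mat (Suc r) (Suc n)
    (\<lambda>(i, j). if i < r \<and> j < n then A $$ (i, j) else if i = r \<and> j = n then 1 else 0)"
  have Ac: "A \<in> carrier_mat r n" using A by (simp add: nrb_matrix_def)
  have Bc: "B \<in> carrier_mat (Suc r) (Suc n)" by (simp add: B_def)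
  have col: "(\<Sum>i<Suc r. y i * B $$ (i, j)) = (\<Sum>i<r. y i * A $$ (i, j))" if "j < n" for y j
    using that by (simp add: B_def)
  have coln: "(\<Sum>i<Suc r. y i * B $$ (i, n)) = y r" for y
    by (simp add: B_def)
  have inv_insert: "invertible_mat (submatrix B UNIV (insert n J)) \<longleftrightarrow>
      invertible_mat (submatrix A UNIV J)" if J: "J \<subseteq> {0..<n}" "card J = r" for J
  proof -
    have fJ: "finite J" "n \<notin> J" using J finite_subset by auto
    have J': "insert n J \<subseteq> {0..<Suc n}" "card (insert n J) = Suc r" using J fJ by auto
    have colJ: "(\<Sum>i<Suc r. y i * B $$ (i, j)) = (\<Sum>i<r. y i * A $$ (i, j))" if "j \<in> J" for y j
      using col that J by auto
    have "(\<forall>y. (\<forall>j\<in>insert n J. (\<Sum>i<Suc r. y i * B $$ (i, j)) = 0) \<longrightarrow> (\<forall>i<Suc r. y i = 0)) \<longleftrightarrow>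
      (\<forall>y. y r = 0 \<and> (\<forall>j\<in>J. (\<Sum>i<r. y i * A $$ (i, j)) = 0) \<longrightarrow> (\<forall>i<r. y i = 0))"
      using colJ coln by (auto simp: less_Suc_eq simp del: sum.lessThan_Suc)
    also have "\<dots> \<longleftrightarrow> (\<forall>y. (\<forall>j\<in>J. (\<Sum>i<r. y i * A $$ (i, j)) = 0) \<longrightarrow> (\<forall>i<r. y i = 0))"
    proof (intro iffI allI impI)
      fix y i
      assume *: "\<forall>y. y r = 0 \<and> (\<forall>j\<in>J. (\<Sum>i<r. y i * A $$ (i, j)) = 0) \<longrightarrow> (\<forall>i<r. y i = 0)"
        and y: "\<forall>j\<in>J. (\<Sum>i<r. y i * A $$ (i, j)) = 0" and i: "i < r"
      have "\<forall>i<r. (y(r := 0)) i = 0" using y by (intro *[THEN spec, THEN mp]) auto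
      thus "y i = 0" using i by auto
    qed blast
    finally show ?thesis
      using invertible_submatrix_iff[OF Bc J'] invertible_submatrix_iff[OF Ac J] by simp
  qed
  have last: "n \<in> J" if J: "J \<subseteq> {0..<Suc n}" "card J = Suc r"
    "invertible_mat (submatrix B UNIV J)" for J
  proof (rule ccontr)
    assume "n \<notin> J"
    hence "\<forall>j\<in>J. j < n" using J by (auto simp: less_Suc_eq)
    hence "\<forall>j\<in>J. (\<Sum>i<Suc r. (if i = r then 1 else 0) * B $$ (i, j)) = 0"
      using col by (simp del: sum.lessThan_Suc)
    from invertible_submatrix_iff[OF Bc J(1,2), THEN iffD1, OF J(3), rule_format, OF this[rule_format], of r]
    show False by simp
  qed
  have "bij_betw (insert n)
     {J. J \<subseteq> {0..<n} \<and> card J = r \<and> invertible_mat (submatrix A UNIV J)}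
     {J. J \<subseteq> {0..<Suc n} \<and> card J = Suc r \<and> invertible_mat (submatrix B UNIV J)}"
    (is "bij_betw _ ?X ?Y")
  proof (rule bij_betw_byWitness[where f' = "\<lambda>J. J - {n}"])
    show "\<forall>J\<in>?X. insert n J - {n} = J" by auto
    show "\<forall>J\<in>?Y. insert n (J - {n}) = J" using last by auto
    show "insert n ` ?X \<subseteq> ?Y"
    proof clarify
      fix J assume J: "J \<subseteq> {0..<n}" "r = card J" "invertible_mat (submatrix A UNIV J)"
      have "finite J" "n \<notin> J" using J finite_subset by auto
      thus "insert n J \<subseteq> {0..<Suc n} \<and> card (insert n J) = Suc (card J) \<and>
          invertible_mat (submatrix B UNIV (insert n J))"
        using J inv_insert[of J] by auto
    qed
    show "(\<lambda>J. J - {n}) ` ?Y \<subseteq> ?X"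
    proof clarify
      fix J assume J: "J \<subseteq> {0..<Suc n}" "card J = Suc r" "invertible_mat (submatrix B UNIV J)"
      have nJ: "insert n (J - {n}) = J" "n \<in> J" using last[OF J] by auto
      have "J - {n} \<subseteq> {0..<n}" using J by (auto simp: less_Suc_eq)
      moreover have "card (J - {n}) = r" using J nJ by simp
      ultimately show "J - {n} \<subseteq> {0..<n} \<and> card (J - {n}) = r \<and>
          invertible_mat (submatrix A UNIV (J - {n}))"
        using inv_insert[of "J - {n}"] nJ J by simp
    qed
  qed
  from bij_betw_same_card[OF this] A Bc show ?thesis by (auto simp: nrb_matrix_def)
qed

theorem theorem3p4:
  fixes k r\<^sub>0 :: nat
  assumes "k \<ge> 3"
    and "r\<^sub>0 \<ge> 1"
    and "\<forall>r \<ge> r\<^sub>0. \<forall>m \<le> (r + k - 1) choose (k - 1). binomial_representable k r m"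
  shows "\<forall>r \<ge> r\<^sub>0. \<forall>n b. n = r + k \<longrightarrow> (r\<^sub>0 + k - 1) choose k \<le> b \<longrightarrow> b \<le> n choose r \<longrightarrow>
    (\<exists>A. nrb_matrix n r b A)"
proof -
  \<comment> \<open>By Pascal's rule, the lower bound on \<open>b\<close> says that the number of singular submatrices is in the
    range covered by the hypothesis on \<open>r\<^sub>0\<close>.\<close>
  have few_singular: "\<exists>A. nrb_matrix (r + k) r b A"
    if r: "r \<ge> r\<^sub>0" and b: "(r + k - 1) choose k \<le> b" "b \<le> (r + k) choose k" for r b
  proof -
    have "(r + k) choose k = (r + k - 1 choose (k - 1)) + (r + k - 1 choose k)"
      using assms(1) choose_reduce_nat[of "r + k" k] by simp
    hence "((r + k) choose k) - b \<le> (r + k - 1) choose (k - 1)" using b by linarith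
    hence "binomial_representable k r (((r + k) choose k) - b)" using assms(3) r by blast
    from exists_nrb_matrix_of_representable[OF assms(1) this] show ?thesis using b by simp
  qed
  have "\<exists>A. nrb_matrix (r + k) r b A"
    if "r \<ge> r\<^sub>0" "(r\<^sub>0 + k - 1) choose k \<le> b" "b \<le> (r + k) choose k" for r b
    using that
  proof (induction r rule: nat_induct_at_least)
    case base
    thus ?case by (intro few_singular) auto
  next
    case (Suc r)
    show ?case
    proof (cases "b \<le> (r + k) choose k")
      case True
      thus ?thesis using Suc exists_nrb_matrix_Suc by fastforce
    next
      case False
      thus ?thesis using Suc by (intro few_singular) auto
    qed
  qed
  moreover have "(r + k) choose r = (r + k) choose k" for r
    using binomial_symmetric[of k "r + k"] by simp
  ultimately show ?thesis by simp
qed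

end
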